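(* Let $G$ be a torsion-free group and let $0\neq\alpha=\sum_{g\in G}a_g g\in\mathbb{C}G$. If $2\|\alpha\|_2^2\geq\|\alpha\|_1^2$, then $\alpha$ is regular, i.e. $\alpha\beta\neq 0$ for every $0\neq\beta\in\mathbb{C}G$.
   Context: $\mathbb{C}G$ is the complex group algebra of $G$: finitely supported functions $G\to\mathbb{C}$, written as formal sums $\alpha=\sum_{g\in G}a_g g$, with the usual convolution product $\big(\sum_g a_g g\big)\big(\sum_h b_h h\big)=\sum_{g,h}a_g b_h\,gh$. The norms are $\|\alpha\|_1=\sum_{g\in G}|a_g|$ and $\|\alpha\|_2=\big(\sum_{g\in G}|a_g|^2\big)^{1/2}$. An element $\alpha\in\mathbb{C}G$ is called regular if $\alpha\beta\neq0$ for all $0\neq\beta\in\mathbb{C}G$. *)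

theory Defs
  imports Complex_Main "HOL-Algebra.Ring" "HOL-Library.Poly_Mapping"
begin

definition torsion_free :: "('a, 'b) monoid_scheme \<Rightarrow> bool" where
  "torsion_free G \<longleftrightarrow>
    (\<forall>g \<in> carrier G. \<forall>n > 0. g [^]\<^bsub>G\<^esub> (n::nat) = \<one>\<^bsub>G\<^esub> \<longrightarrow> g = \<one>\<^bsub>G\<^esub>)"

text \<open>
  The complex group algebra of \<open>G\<close>. Finitely supported functions are elements of
  \<^typ>\<open>'a \<Rightarrow>\<^sub>0 complex\<close>; since \<open>G\<close> is a group on a carrier set, the support is required to lie
  in that carrier. The product is written out here because the convolution product on
  \<^typ>\<open>'a \<Rightarrow>\<^sub>0 complex\<close> in the library uses type class addition on \<^typ>\<open>'a\<close> instead of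
  the multiplication of \<open>G\<close>.
\<close>
definition group_algebra :: "('a, 'b) monoid_scheme \<Rightarrow> ('a \<Rightarrow>\<^sub>0 complex) ring" where
  "group_algebra G =
    \<lparr>carrier = {\<alpha>. Poly_Mapping.keys \<alpha> \<subseteq> carrier G},
     mult = (\<lambda>\<alpha> \<beta>. \<Sum>g \<in> Poly_Mapping.keys \<alpha>. \<Sum>h \<in> Poly_Mapping.keys \<beta>.
        Poly_Mapping.single (g \<otimes>\<^bsub>G\<^esub> h) (Poly_Mapping.lookup \<alpha> g * Poly_Mapping.lookup \<beta> h)),
     one = Poly_Mapping.single \<one>\<^bsub>G\<^esub> 1,
     zero = 0,
     add = (+)\<rparr>"

definition norm1 :: "('a \<Rightarrow>\<^sub>0 complex) \<Rightarrow> real" where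
  "norm1 \<alpha> = (\<Sum>g \<in> Poly_Mapping.keys \<alpha>. cmod (Poly_Mapping.lookup \<alpha> g))"

definition norm2 :: "('a \<Rightarrow>\<^sub>0 complex) \<Rightarrow> real" where
  "norm2 \<alpha> = sqrt (\<Sum>g \<in> Poly_Mapping.keys \<alpha>. (cmod (Poly_Mapping.lookup \<alpha> g))\<^sup>2)"

definition regular :: "('a, 'b) monoid_scheme \<Rightarrow> ('a \<Rightarrow>\<^sub>0 complex) \<Rightarrow> bool" where
  "regular G \<alpha> \<longleftrightarrow>
    (\<forall>\<beta> \<in> carrier (group_algebra G). \<beta> \<noteq> \<zero>\<^bsub>group_algebra G\<^esub> \<longrightarrow>
      \<alpha> \<otimes>\<^bsub>group_algebra G\<^esub> \<beta> \<noteq> \<zero>\<^bsub>group_algebra G\<^esub>)"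

lemma group_algebra_simps:
  "carrier (group_algebra G) = {\<alpha>. Poly_Mapping.keys \<alpha> \<subseteq> carrier G}"
  "\<one>\<^bsub>group_algebra G\<^esub> = Poly_Mapping.single \<one>\<^bsub>G\<^esub> 1"
  "\<zero>\<^bsub>group_algebra G\<^esub> = 0"
  "\<alpha> \<oplus>\<^bsub>group_algebra G\<^esub> \<beta> = \<alpha> + \<beta>"
  by (simp_all add: group_algebra_def)

lemma group_algebra_mult_superset:
  assumes "finite A" "finite B" "Poly_Mapping.keys \<alpha> \<subseteq> A" "Poly_Mapping.keys \<beta> \<subseteq> B"
  shows "\<alpha> \<otimes>\<^bsub>group_algebra G\<^esub> \<beta> = (\<Sum>g \<in> A. \<Sum>h \<in> B.
    Poly_Mapping.single (g \<otimes>\<^bsub>G\<^esub> h) (Poly_Mapping.lookup \<alpha> g * Poly_Mapping.lookup \<beta> h))"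
proof -
  have "(\<Sum>g \<in> A. \<Sum>h \<in> B.
      Poly_Mapping.single (g \<otimes>\<^bsub>G\<^esub> h) (Poly_Mapping.lookup \<alpha> g * Poly_Mapping.lookup \<beta> h))
    = (\<Sum>g \<in> A. \<Sum>h \<in> Poly_Mapping.keys \<beta>.
      Poly_Mapping.single (g \<otimes>\<^bsub>G\<^esub> h) (Poly_Mapping.lookup \<alpha> g * Poly_Mapping.lookup \<beta> h))"
    using assms by (intro sum.cong sum.mono_neutral_right) (auto simp: in_keys_iff)
  also have "\<dots> = (\<Sum>g \<in> Poly_Mapping.keys \<alpha>. \<Sum>h \<in> Poly_Mapping.keys \<beta>.
      Poly_Mapping.single (g \<otimes>\<^bsub>G\<^esub> h) (Poly_Mapping.lookup \<alpha> g * Poly_Mapping.lookup \<beta> h))"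
    using assms by (intro sum.mono_neutral_right) (auto simp: in_keys_iff)
  finally show ?thesis by (simp add: group_algebra_def)
qed

lemma group_algebra_add_mult:
  "(\<alpha> + \<beta>) \<otimes>\<^bsub>group_algebra G\<^esub> \<gamma> =
    \<alpha> \<otimes>\<^bsub>group_algebra G\<^esub> \<gamma> + \<beta> \<otimes>\<^bsub>group_algebra G\<^esub> \<gamma>"
proof -
  let ?A = "Poly_Mapping.keys \<alpha> \<union> Poly_Mapping.keys \<beta>"
  have "Poly_Mapping.keys (\<alpha> + \<beta>) \<subseteq> ?A" by (rule Poly_Mapping.keys_add)
  then show ?thesis
    by (simp add: group_algebra_mult_superset[of ?A "Poly_Mapping.keys \<gamma>"]
        lookup_add ring_distribs single_add sum.distrib)
qed

lemma group_algebra_mult_add: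
  "\<gamma> \<otimes>\<^bsub>group_algebra G\<^esub> (\<alpha> + \<beta>) =
    \<gamma> \<otimes>\<^bsub>group_algebra G\<^esub> \<alpha> + \<gamma> \<otimes>\<^bsub>group_algebra G\<^esub> \<beta>"
proof -
  let ?A = "Poly_Mapping.keys \<alpha> \<union> Poly_Mapping.keys \<beta>"
  have "Poly_Mapping.keys (\<alpha> + \<beta>) \<subseteq> ?A" by (rule Poly_Mapping.keys_add)
  then show ?thesis
    by (simp add: group_algebra_mult_superset[of "Poly_Mapping.keys \<gamma>" ?A]
        lookup_add ring_distribs single_add sum.distrib)
qed

lemma group_algebra_mult_zero:
  "0 \<otimes>\<^bsub>group_algebra G\<^esub> \<alpha> = 0" "\<alpha> \<otimes>\<^bsub>group_algebra G\<^esub> 0 = 0"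
  by (simp_all add: group_algebra_def)

lemma group_algebra_sum_mult:
  "sum f A \<otimes>\<^bsub>group_algebra G\<^esub> \<gamma> = (\<Sum>x\<in>A. f x \<otimes>\<^bsub>group_algebra G\<^esub> \<gamma>)"
  by (induction A rule: infinite_finite_induct)
    (simp_all add: group_algebra_mult_zero group_algebra_add_mult)

lemma group_algebra_mult_sum:
  "\<gamma> \<otimes>\<^bsub>group_algebra G\<^esub> sum f A = (\<Sum>x\<in>A. \<gamma> \<otimes>\<^bsub>group_algebra G\<^esub> f x)"
  by (induction A rule: infinite_finite_induct)
    (simp_all add: group_algebra_mult_zero group_algebra_mult_add)

lemma group_algebra_single_mult:
  "Poly_Mapping.single g a \<otimes>\<^bsub>group_algebra G\<^esub> Poly_Mapping.single h b =
    Poly_Mapping.single (g \<otimes>\<^bsub>G\<^esub> h) (a * b)"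
  by (simp add: group_algebra_mult_superset[of "{g}" "{h}"])

lemma group_algebra_single_sum:
  "\<alpha> = (\<Sum>g\<in>Poly_Mapping.keys \<alpha>. Poly_Mapping.single g (Poly_Mapping.lookup \<alpha> g))"
  for \<alpha> :: "'a \<Rightarrow>\<^sub>0 complex"
  by (rule poly_mapping_eqI) (auto simp: lookup_sum lookup_single when_def in_keys_iff)

lemma group_algebra_mult_closed:
  assumes "group G" "\<alpha> \<in> carrier (group_algebra G)" "\<beta> \<in> carrier (group_algebra G)"
  shows "\<alpha> \<otimes>\<^bsub>group_algebra G\<^esub> \<beta> \<in> carrier (group_algebra G)"
proof -
  interpret group G by fact
  have "Poly_Mapping.keys (\<Sum>g \<in> Poly_Mapping.keys \<alpha>. \<Sum>h \<in> Poly_Mapping.keys \<beta>.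
      Poly_Mapping.single (g \<otimes>\<^bsub>G\<^esub> h) (Poly_Mapping.lookup \<alpha> g * Poly_Mapping.lookup \<beta> h))
    \<subseteq> (\<Union>g \<in> Poly_Mapping.keys \<alpha>. \<Union>h \<in> Poly_Mapping.keys \<beta>. {g \<otimes>\<^bsub>G\<^esub> h})"
    by (intro order.trans[OF keys_sum] UN_mono order_refl) auto
  also have "\<dots> \<subseteq> carrier G"
    using assms(2,3) by (auto simp: group_algebra_simps)
  finally show ?thesis by (simp add: group_algebra_def)
qed

lemma group_algebra_assoc:
  assumes "group G" "\<alpha> \<in> carrier (group_algebra G)" "\<beta> \<in> carrier (group_algebra G)"
    "\<gamma> \<in> carrier (group_algebra G)"
  shows "\<alpha> \<otimes>\<^bsub>group_algebra G\<^esub> \<beta> \<otimes>\<^bsub>group_algebra G\<^esub> \<gamma> =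
    \<alpha> \<otimes>\<^bsub>group_algebra G\<^esub> (\<beta> \<otimes>\<^bsub>group_algebra G\<^esub> \<gamma>)"
proof -
  interpret group G by fact
  let ?s = "\<lambda>\<alpha> g. Poly_Mapping.single g (Poly_Mapping.lookup \<alpha> g) :: 'a \<Rightarrow>\<^sub>0 complex"
  have "(\<Sum>g\<in>Poly_Mapping.keys \<alpha>. ?s \<alpha> g) \<otimes>\<^bsub>group_algebra G\<^esub>
      (\<Sum>h\<in>Poly_Mapping.keys \<beta>. ?s \<beta> h) \<otimes>\<^bsub>group_algebra G\<^esub>
      (\<Sum>k\<in>Poly_Mapping.keys \<gamma>. ?s \<gamma> k) =
    (\<Sum>g\<in>Poly_Mapping.keys \<alpha>. ?s \<alpha> g) \<otimes>\<^bsub>group_algebra G\<^esub>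
      ((\<Sum>h\<in>Poly_Mapping.keys \<beta>. ?s \<beta> h) \<otimes>\<^bsub>group_algebra G\<^esub>
      (\<Sum>k\<in>Poly_Mapping.keys \<gamma>. ?s \<gamma> k))"
    unfolding group_algebra_sum_mult group_algebra_mult_sum group_algebra_single_mult
    using assms(2-4) by (intro sum.cong refl) (auto simp: group_algebra_simps m_assoc subset_eq mult.assoc)
  then show ?thesis by (simp flip: group_algebra_single_sum)
qed

lemma group_algebra_ring:
  assumes "group G"
  shows "ring (group_algebra G)"
proof -
  interpret group G by fact
  have one: "\<one>\<^bsub>group_algebra G\<^esub> \<otimes>\<^bsub>group_algebra G\<^esub> \<alpha> = \<alpha>"
      "\<alpha> \<otimes>\<^bsub>group_algebra G\<^esub> \<one>\<^bsub>group_algebra G\<^esub> = \<alpha>"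
    if "\<alpha> \<in> carrier (group_algebra G)" for \<alpha>
  proof -
    have *: "Poly_Mapping.keys \<alpha> \<subseteq> carrier G"
      using that by (simp add: group_algebra_simps)
    have "\<one>\<^bsub>group_algebra G\<^esub> \<otimes>\<^bsub>group_algebra G\<^esub> \<alpha> =
        (\<Sum>g\<in>Poly_Mapping.keys \<alpha>. Poly_Mapping.single g (Poly_Mapping.lookup \<alpha> g))"
      using * by (auto simp: group_algebra_simps
          group_algebra_mult_superset[of "{\<one>\<^bsub>G\<^esub>}" "Poly_Mapping.keys \<alpha>"] intro!: sum.cong)
    then show "\<one>\<^bsub>group_algebra G\<^esub> \<otimes>\<^bsub>group_algebra G\<^esub> \<alpha> = \<alpha>"
      by (simp flip: group_algebra_single_sum)
    have "\<alpha> \<otimes>\<^bsub>group_algebra G\<^esub> \<one>\<^bsub>group_algebra G\<^esub> =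
        (\<Sum>g\<in>Poly_Mapping.keys \<alpha>. Poly_Mapping.single g (Poly_Mapping.lookup \<alpha> g))"
      using * by (auto simp: group_algebra_simps
          group_algebra_mult_superset[of "Poly_Mapping.keys \<alpha>" "{\<one>\<^bsub>G\<^esub>}"] intro!: sum.cong)
    then show "\<alpha> \<otimes>\<^bsub>group_algebra G\<^esub> \<one>\<^bsub>group_algebra G\<^esub> = \<alpha>"
      by (simp flip: group_algebra_single_sum)
  qed
  show ?thesis
  proof (rule ringI)
    show "abelian_group (group_algebra G)"
    proof (rule abelian_groupI)
      fix \<alpha> assume "\<alpha> \<in> carrier (group_algebra G)"
      then show "\<exists>\<beta>\<in>carrier (group_algebra G).
          \<beta> \<oplus>\<^bsub>group_algebra G\<^esub> \<alpha> = \<zero>\<^bsub>group_algebra G\<^esub>"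
        by (intro bexI[of _ "- \<alpha>"]) (auto simp: group_algebra_simps)
    qed (use Poly_Mapping.keys_add in \<open>fastforce simp: group_algebra_simps add_ac\<close>)+
    show "monoid (group_algebra G)"
    proof (rule monoidI)
      show "\<one>\<^bsub>group_algebra G\<^esub> \<in> carrier (group_algebra G)"
        by (simp add: group_algebra_simps)
    qed (simp_all add: group_algebra_assoc group_algebra_mult_closed one assms)
  qed (simp_all add: group_algebra_simps group_algebra_add_mult group_algebra_mult_add)
qed

end

theory Submission
  imports Defs
begin

text \<open>
  If \<open>\<alpha>\<beta> = 0\<close>, expanding \<open>\<parallel>\<alpha>\<beta>\<parallel>\<^sub>2\<^sup>2 = 0\<close> gives \<open>\<Sum>\<^sub>g\<^sub>,\<^sub>h a\<^sub>g \<cdot> cnj a\<^sub>h \<cdot> \<langle>g\<beta>, h\<beta>\<rangle> = 0\<close>. The diagonal contributes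
  \<open>\<parallel>\<alpha>\<parallel>\<^sub>2\<^sup>2 \<parallel>\<beta>\<parallel>\<^sub>2\<^sup>2\<close>, and by Cauchy-Schwarz the rest is bounded by
  \<open>(\<parallel>\<alpha>\<parallel>\<^sub>1\<^sup>2 - \<parallel>\<alpha>\<parallel>\<^sub>2\<^sup>2) \<parallel>\<beta>\<parallel>\<^sub>2\<^sup>2 \<le> \<parallel>\<alpha>\<parallel>\<^sub>2\<^sup>2 \<parallel>\<beta>\<parallel>\<^sub>2\<^sup>2\<close>. Unless \<open>\<alpha>\<close> has a single term (and
  there is no rest), the bound is strict because equality in Cauchy-Schwarz
  would make the finite support of \<open>\<beta>\<close> invariant under \<open>h\<^sup>-\<^sup>1g\<close>, which has infinite order.
\<close>

text \<open>A strict Cauchy-Schwarz for vectors of equal norm. Termwise the modulus is at most the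
  mean of the two squares, with a gap of half of \<open>(cmod (u k) - cmod (v k))\<^sup>2\<close>,
  and these means add up to exactly \<open>N\<close>. One index with different moduli therefore
  makes the inequality strict.\<close>

lemma norm_sum_mult_cnj_less:
  fixes u v :: "'k \<Rightarrow> complex"
  assumes "finite S" "(\<Sum>k\<in>S. (cmod (u k))\<^sup>2) = N" "(\<Sum>k\<in>S. (cmod (v k))\<^sup>2) = N"
    and "k \<in> S" "cmod (u k) \<noteq> cmod (v k)"
  shows "cmod (\<Sum>k\<in>S. u k * cnj (v k)) < N"
proof -
  have amgm: "(cmod (u k))\<^sup>2 + (cmod (v k))\<^sup>2 - 2 * (cmod (u k) * cmod (v k)) =
      (cmod (u k) - cmod (v k))\<^sup>2" for k
    by (simp add: power2_diff)
  have "cmod (\<Sum>k\<in>S. u k * cnj (v k)) \<le> (\<Sum>k\<in>S. cmod (u k) * cmod (v k))"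
    by (rule sum_norm_le) (simp add: norm_mult)
  also have "\<dots> < (\<Sum>k\<in>S. ((cmod (u k))\<^sup>2 + (cmod (v k))\<^sup>2) / 2)"
  proof (rule sum_strict_mono_ex1)
    show "\<exists>k\<in>S. cmod (u k) * cmod (v k) < ((cmod (u k))\<^sup>2 + (cmod (v k))\<^sup>2) / 2"
    proof
      have "0 < (cmod (u k) - cmod (v k))\<^sup>2" using assms(5) by simp
      then show "cmod (u k) * cmod (v k) < ((cmod (u k))\<^sup>2 + (cmod (v k))\<^sup>2) / 2"
        unfolding amgm[symmetric] by simp
    qed fact
    show "\<forall>k\<in>S. cmod (u k) * cmod (v k) \<le> ((cmod (u k))\<^sup>2 + (cmod (v k))\<^sup>2) / 2"
    proof
      fix k
      show "cmod (u k) * cmod (v k) \<le> ((cmod (u k))\<^sup>2 + (cmod (v k))\<^sup>2) / 2"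
        using zero_le_power2[of "cmod (u k) - cmod (v k)"] unfolding amgm[symmetric] by simp
    qed
  qed fact
  also have "\<dots> = N"
    using assms(2,3) by (simp add: sum.distrib flip: sum_divide_distrib)
  finally show ?thesis .
qed

text \<open>The group-free core: \<open>u g\<close> stands for the translate of \<beta> by
  \<open>g\<close>. If the combination vanished on \<open>S\<close>, the off-diagonal Gram terms
  would have to cancel the diagonal, but strictly small inner products leave them too small under
  \<open>norms\<close>.\<close>

lemma exists_nonzero_combination:
  fixes a :: "'i \<Rightarrow> complex" and u :: "'i \<Rightarrow> 'k \<Rightarrow> complex"
  assumes A: "finite A" "A \<noteq> {}" and a: "\<And>g. g \<in> A \<Longrightarrow> a g \<noteq> 0"
    and N: "N > 0" "\<And>g. g \<in> A \<Longrightarrow> (\<Sum>k\<in>S. (cmod (u g k))\<^sup>2) = N"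
    and less: "\<And>g h. g \<in> A \<Longrightarrow> h \<in> A \<Longrightarrow> g \<noteq> h \<Longrightarrow> cmod (\<Sum>k\<in>S. u g k * cnj (u h k)) < N"
    and norms: "(\<Sum>g\<in>A. cmod (a g))\<^sup>2 \<le> 2 * (\<Sum>g\<in>A. (cmod (a g))\<^sup>2)"
  shows "\<exists>k\<in>S. (\<Sum>g\<in>A. a g * u g k) \<noteq> 0"
proof (rule ccontr)
  assume "\<not> (\<exists>k\<in>S. (\<Sum>g\<in>A. a g * u g k) \<noteq> 0)"
  then have zero: "(\<Sum>g\<in>A. a g * u g k) = 0" if "k \<in> S" for k using that by blast
  define I where "I g h = (\<Sum>k\<in>S. u g k * cnj (u h k))" for g h
  define D where "D = (\<Sum>g\<in>A. (cmod (a g))\<^sup>2)"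
  let ?P = "SIGMA g:A. A - {g}"
  have finP: "finite ?P" using A(1) by blast
  \<comment> \<open>The value type stays general because the splitting serves both the complex Gram
    sum and the real products of moduli.\<close>
  have split: "(\<Sum>g\<in>A. \<Sum>h\<in>A. F g h) = (\<Sum>g\<in>A. F g g) + (\<Sum>(g, h)\<in>?P. F g h)"
    for F :: "'i \<Rightarrow> 'i \<Rightarrow> 'c::comm_monoid_add"
  proof -
    have "(\<Sum>g\<in>A. \<Sum>h\<in>A. F g h) = (\<Sum>g\<in>A. F g g + (\<Sum>h\<in>A - {g}. F g h))"
      using A(1) by (intro sum.cong refl sum.remove)
    then show ?thesis using A(1) by (simp add: sum.distrib sum.Sigma)
  qed
  have D_pos: "D > 0"
    unfolding D_def using A a by (intro sum_pos) auto
  have I_diag: "I g g = of_real N" if "g \<in> A" for g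
    unfolding I_def complex_norm_square[symmetric] of_real_sum[symmetric] N(2)[OF that] ..
  \<comment> \<open>The squared norm of the combination, expanded into the inner products
    \<open>I g h\<close>.\<close>
  have "0 = (\<Sum>k\<in>S. (\<Sum>g\<in>A. a g * u g k) * cnj (\<Sum>h\<in>A. a h * u h k))"
    using zero by simp
  also have "\<dots> = (\<Sum>k\<in>S. \<Sum>g\<in>A. \<Sum>h\<in>A. a g * cnj (a h) * (u g k * cnj (u h k)))"
    by (simp add: cnj_sum sum_product mult_ac)
  also have "\<dots> = (\<Sum>g\<in>A. \<Sum>h\<in>A. a g * cnj (a h) * I g h)"
    unfolding I_def sum_distrib_left by (subst sum.swap, rule sum.cong[OF refl], rule sum.swap)
  also have "\<dots> = (\<Sum>g\<in>A. a g * cnj (a g) * I g g) + (\<Sum>(g, h)\<in>?P. a g * cnj (a h) * I g h)"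
    by (rule split)
  also have "(\<Sum>g\<in>A. a g * cnj (a g) * I g g) = of_real (D * N)"
    by (simp add: I_diag D_def sum_distrib_right flip: complex_norm_square)
  finally have "(\<Sum>(g, h)\<in>?P. a g * cnj (a h) * I g h) = - of_real (D * N)"
    by (simp add: eq_neg_iff_add_eq_0 add.commute)
  then have "D * N = cmod (\<Sum>(g, h)\<in>?P. a g * cnj (a h) * I g h)"
    using D_pos N(1) by (simp add: norm_mult)
  also have "\<dots> \<le> (\<Sum>(g, h)\<in>?P. cmod (a g) * cmod (a h) * cmod (I g h))"
    by (rule sum_norm_le) (auto simp: norm_mult)
  finally have le: "D * N \<le> (\<Sum>(g, h)\<in>?P. cmod (a g) * cmod (a h) * cmod (I g h))" .
  \<comment> \<open>Strictness needs at least one off-diagonal pair; without one, \<open>le\<close>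
    would bound the positive \<open>D * N\<close> by an empty sum.\<close>
  have "?P \<noteq> {}"
  proof
    assume "?P = {}"
    then show False
      using le mult_pos_pos[OF D_pos N(1)] by (simp only: sum.empty)
  qed
  with finP have "(\<Sum>(g, h)\<in>?P. cmod (a g) * cmod (a h) * cmod (I g h)) <
      (\<Sum>(g, h)\<in>?P. cmod (a g) * cmod (a h) * N)"
    by (rule sum_strict_mono)
      (use a less[folded I_def] in \<open>auto intro!: mult_strict_left_mono\<close>)
  also have "\<dots> = (\<Sum>(g, h)\<in>?P. cmod (a g) * cmod (a h)) * N"
    by (simp add: sum_distrib_right case_prod_beta)
  also have "(\<Sum>(g, h)\<in>?P. cmod (a g) * cmod (a h)) = (\<Sum>g\<in>A. cmod (a g))\<^sup>2 - D"
    using split[of "\<lambda>g h. cmod (a g) * cmod (a h)"]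
    by (simp add: D_def power2_eq_square sum_product)
  also have "\<dots> * N \<le> D * N"
    using norms N(1) by (intro mult_right_mono) (auto simp: D_def)
  finally show False using le by simp
qed

text \<open>All points \<open>x [^] n \<otimes> k\<close> lie in the finite set \<open>K\<close>, so
  two of them coincide. Cancelling \<open>k\<close> leaves a positive power of \<open>x\<close>
  equal to the identity.\<close>

lemma torsion_free_finite_invariant_set:
  assumes "group G" "torsion_free G" "x \<in> carrier G"
    and K: "finite K" "K \<noteq> {}" "K \<subseteq> carrier G" "\<And>k. k \<in> K \<Longrightarrow> x \<otimes>\<^bsub>G\<^esub> k \<in> K"
  shows "x = \<one>\<^bsub>G\<^esub>"
proof -
  interpret group G by fact
  obtain k where k: "k \<in> K" using K(2) by blast
  have kG: "k \<in> carrier G" using k K(3) by blast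
  have orbit: "x [^]\<^bsub>G\<^esub> n \<otimes>\<^bsub>G\<^esub> k \<in> K" for n :: nat
  proof (induction n)
    case (Suc n)
    have "x [^]\<^bsub>G\<^esub> Suc n \<otimes>\<^bsub>G\<^esub> k = x \<otimes>\<^bsub>G\<^esub> (x [^]\<^bsub>G\<^esub> n \<otimes>\<^bsub>G\<^esub> k)"
      unfolding nat_pow_Suc2[OF assms(3)] using assms(3) kG by (simp add: m_assoc)
    with K(4)[OF Suc.IH] show ?case by simp
  qed (use k kG in simp)
  then have "\<not> inj (\<lambda>n::nat. x [^]\<^bsub>G\<^esub> n \<otimes>\<^bsub>G\<^esub> k)"
    using K(1) by (meson finite_subset image_subsetI infinite_UNIV_nat finite_imageD)
  then obtain m n :: nat where "m < n" "x [^]\<^bsub>G\<^esub> m \<otimes>\<^bsub>G\<^esub> k = x [^]\<^bsub>G\<^esub> n \<otimes>\<^bsub>G\<^esub> k"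
    using linorder_injI[of "\<lambda>n::nat. x [^]\<^bsub>G\<^esub> n \<otimes>\<^bsub>G\<^esub> k"] by blast
  then have "x [^]\<^bsub>G\<^esub> (n - m) = \<one>\<^bsub>G\<^esub>"
    using assms(3) kG by (intro pow_eq_div2) auto
  moreover have "n - m > 0" using \<open>m < n\<close> by simp
  ultimately show ?thesis
    using assms(2,3) unfolding torsion_free_def by blast
qed

text \<open>For fixed \<open>g\<close> only \<open>h = inv g \<otimes> k\<close> can contribute.
  This exhibits \<alpha>\<beta> as a combination of left translates of \<beta>.\<close>

lemma lookup_group_algebra_mult:
  assumes "group G" "\<alpha> \<in> carrier (group_algebra G)" "\<beta> \<in> carrier (group_algebra G)"
    and k: "k \<in> carrier G"
  shows "Poly_Mapping.lookup (\<alpha> \<otimes>\<^bsub>group_algebra G\<^esub> \<beta>) k =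
    (\<Sum>g\<in>Poly_Mapping.keys \<alpha>. Poly_Mapping.lookup \<alpha> g * Poly_Mapping.lookup \<beta> (inv\<^bsub>G\<^esub> g \<otimes>\<^bsub>G\<^esub> k))"
proof -
  interpret group G by fact
  have inner: "(\<Sum>h\<in>Poly_Mapping.keys \<beta>. Poly_Mapping.lookup
        (Poly_Mapping.single (g \<otimes>\<^bsub>G\<^esub> h) (Poly_Mapping.lookup \<alpha> g * Poly_Mapping.lookup \<beta> h)) k) =
      Poly_Mapping.lookup \<alpha> g * Poly_Mapping.lookup \<beta> (inv\<^bsub>G\<^esub> g \<otimes>\<^bsub>G\<^esub> k)"
    if "g \<in> Poly_Mapping.keys \<alpha>" for g
  proof -
    have g: "g \<in> carrier G" using that assms(2) by (auto simp: group_algebra_simps)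
    have "(\<Sum>h\<in>Poly_Mapping.keys \<beta>. Poly_Mapping.lookup
        (Poly_Mapping.single (g \<otimes>\<^bsub>G\<^esub> h) (Poly_Mapping.lookup \<alpha> g * Poly_Mapping.lookup \<beta> h)) k) =
      (\<Sum>h\<in>Poly_Mapping.keys \<beta>. if h = inv\<^bsub>G\<^esub> g \<otimes>\<^bsub>G\<^esub> k
        then Poly_Mapping.lookup \<alpha> g * Poly_Mapping.lookup \<beta> h else 0)"
    proof (rule sum.cong[OF refl])
      fix h assume "h \<in> Poly_Mapping.keys \<beta>"
      then have "h \<in> carrier G" using assms(3) by (auto simp: group_algebra_simps)
      then have "g \<otimes>\<^bsub>G\<^esub> h = k \<longleftrightarrow> h = inv\<^bsub>G\<^esub> g \<otimes>\<^bsub>G\<^esub> k"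
        using g k inv_solve_left by metis
      then show "Poly_Mapping.lookup
          (Poly_Mapping.single (g \<otimes>\<^bsub>G\<^esub> h) (Poly_Mapping.lookup \<alpha> g * Poly_Mapping.lookup \<beta> h)) k =
        (if h = inv\<^bsub>G\<^esub> g \<otimes>\<^bsub>G\<^esub> k then Poly_Mapping.lookup \<alpha> g * Poly_Mapping.lookup \<beta> h else 0)"
        by (simp add: lookup_single when_def)
    qed
    \<comment> \<open>If \<open>inv g \<otimes> k\<close> lies outside the support of \<beta>, no
      summand is selected, and the lookup on the right is 0 as well.\<close>
    also have "\<dots> = Poly_Mapping.lookup \<alpha> g * Poly_Mapping.lookup \<beta> (inv\<^bsub>G\<^esub> g \<otimes>\<^bsub>G\<^esub> k)"
      by (simp add: in_keys_iff)
    finally show ?thesis .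
  qed
  show ?thesis
    by (simp add: group_algebra_def lookup_sum inner)
qed

theorem theorem1p1:
  fixes G :: "('a, 'b) monoid_scheme" and \<alpha> :: "'a \<Rightarrow>\<^sub>0 complex"
  assumes "group G"
    and "torsion_free G"
    and "\<alpha> \<in> carrier (group_algebra G)"
    and "\<alpha> \<noteq> \<zero>\<^bsub>group_algebra G\<^esub>"
    and "2 * (norm2 \<alpha>)\<^sup>2 \<ge> (norm1 \<alpha>)\<^sup>2"
  shows "regular G \<alpha>"
  unfolding regular_def
proof (intro ballI impI notI)
  fix \<beta> assume \<beta>: "\<beta> \<in> carrier (group_algebra G)" "\<beta> \<noteq> \<zero>\<^bsub>group_algebra G\<^esub>"
    and zero: "\<alpha> \<otimes>\<^bsub>group_algebra G\<^esub> \<beta> = \<zero>\<^bsub>group_algebra G\<^esub>"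
  interpret group G by fact
  define A where "A = Poly_Mapping.keys \<alpha>"
  define K where "K = Poly_Mapping.keys \<beta>"
  \<comment> \<open>\<open>S\<close> contains the supports of all translates g\<beta> with
    \<open>g\<close> in \<open>A\<close>, so a sum over \<open>S\<close> sees each translate
    completely.\<close>
  define S where "S = (\<Union>g\<in>A. (\<lambda>k. g \<otimes>\<^bsub>G\<^esub> k) ` K)"
  define b where "b = Poly_Mapping.lookup \<beta>"
  define u where "u g k = b (inv\<^bsub>G\<^esub> g \<otimes>\<^bsub>G\<^esub> k)" for g k
  define N where "N = (\<Sum>k\<in>K. (cmod (b k))\<^sup>2)"
  have A: "finite A" "A \<noteq> {}" "A \<subseteq> carrier G"
    using assms(3,4) by (auto simp: A_def group_algebra_simps)
  have K: "finite K" "K \<noteq> {}" "K \<subseteq> carrier G"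
    using \<beta> by (auto simp: K_def group_algebra_simps)
  have b: "b k \<noteq> 0 \<longleftrightarrow> k \<in> K" for k by (simp add: b_def K_def in_keys_iff)
  have S: "finite S" "S \<subseteq> carrier G"
    using A K by (auto simp: S_def subset_eq)
  have N_pos: "N > 0"
    unfolding N_def using K b by (intro sum_pos) auto
  have sum_u: "(\<Sum>k\<in>S. (cmod (u g k))\<^sup>2) = N" if "g \<in> A" for g
  proof -
    have g: "g \<in> carrier G" using that A by blast
    \<comment> \<open>Translation preserves the norm: \<open>u g\<close> vanishes off gK, and
      reindexing by \<open>g\<close> turns the sum over gK into the one over
      \<open>K\<close>.\<close>
    have "(\<Sum>k\<in>S. (cmod (u g k))\<^sup>2) = (\<Sum>k\<in>(\<lambda>k. g \<otimes>\<^bsub>G\<^esub> k) ` K. (cmod (u g k))\<^sup>2)"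
    proof (intro sum.mono_neutral_right ballI)
      fix k assume k: "k \<in> S - (\<lambda>k. g \<otimes>\<^bsub>G\<^esub> k) ` K"
      then have "k = g \<otimes>\<^bsub>G\<^esub> (inv\<^bsub>G\<^esub> g \<otimes>\<^bsub>G\<^esub> k)"
        using g S by (auto simp flip: m_assoc)
      with k have "inv\<^bsub>G\<^esub> g \<otimes>\<^bsub>G\<^esub> k \<notin> K" by blast
      then show "(cmod (u g k))\<^sup>2 = 0" using b by (auto simp: u_def)
    qed (use S that in \<open>auto simp: S_def\<close>)
    also have "\<dots> = (\<Sum>k\<in>K. (cmod (u g (g \<otimes>\<^bsub>G\<^esub> k)))\<^sup>2)"
      using g K by (subst sum.reindex) (auto simp: inj_on_def subset_eq)
    also have "\<dots> = N"
      unfolding N_def u_def using g K by (intro sum.cong) (auto simp: subset_eq simp flip: m_assoc)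
    finally show ?thesis .
  qed
  have "\<exists>k\<in>S. (\<Sum>g\<in>A. Poly_Mapping.lookup \<alpha> g * u g k) \<noteq> 0"
  proof (rule exists_nonzero_combination[OF A(1,2) _ N_pos sum_u])
    fix g h assume gh: "g \<in> A" "h \<in> A" "g \<noteq> h"
    then have gG: "g \<in> carrier G" and hG: "h \<in> carrier G" using A by auto
    \<comment> \<open>If the moduli agreed on all of \<open>S\<close>, the support of g\<beta> would
      lie in that of h\<beta>, making \<open>K\<close> invariant under
      \<open>inv h \<otimes> g\<close>.\<close>
    have "\<exists>k\<in>S. cmod (u g k) \<noteq> cmod (u h k)"
    proof (rule ccontr)
      assume "\<not> ?thesis"
      then have eq: "cmod (u g k) = cmod (u h k)" if "k \<in> S" for k using that by blast
      have "inv\<^bsub>G\<^esub> h \<otimes>\<^bsub>G\<^esub> g \<otimes>\<^bsub>G\<^esub> k \<in> K" if k: "k \<in> K" for k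
      proof -
        have kG: "k \<in> carrier G" using k K by blast
        have "u g (g \<otimes>\<^bsub>G\<^esub> k) = b k"
          using gG kG by (simp add: u_def flip: m_assoc)
        moreover have "g \<otimes>\<^bsub>G\<^esub> k \<in> S" using gh k by (auto simp: S_def)
        ultimately have "u h (g \<otimes>\<^bsub>G\<^esub> k) \<noteq> 0" using eq b k by fastforce
        then show ?thesis using gG hG kG by (simp add: u_def b m_assoc)
      qed
      then have "inv\<^bsub>G\<^esub> h \<otimes>\<^bsub>G\<^esub> g = \<one>\<^bsub>G\<^esub>"
        by (rule torsion_free_finite_invariant_set[OF assms(1,2) m_closed[OF inv_closed[OF hG] gG] K])
      then have "g = h" using gG hG by (metis inv_closed inv_equality inv_inv)
      with gh show False by blast
    qed
    then obtain k where "k \<in> S" "cmod (u g k) \<noteq> cmod (u h k)" by blast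
    then show "cmod (\<Sum>k\<in>S. u g k * cnj (u h k)) < N"
      by (rule norm_sum_mult_cnj_less[OF S(1) sum_u[OF gh(1)] sum_u[OF gh(2)]])
  next
    show "(\<Sum>g\<in>A. cmod (Poly_Mapping.lookup \<alpha> g))\<^sup>2 \<le> 2 * (\<Sum>g\<in>A. (cmod (Poly_Mapping.lookup \<alpha> g))\<^sup>2)"
      using assms(5) by (simp add: norm1_def norm2_def A_def sum_nonneg)
  qed (auto simp: A_def in_keys_iff)
  then obtain k where "k \<in> S" "(\<Sum>g\<in>A. Poly_Mapping.lookup \<alpha> g * u g k) \<noteq> 0" by blast
  \<comment> \<open>This nonzero combination is the coefficient at \<open>k\<close> of
    \<alpha>\<beta>, which is 0.\<close>
  with S zero show False
    using lookup_group_algebra_mult[OF assms(1,3) \<beta>(1), of k]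
    by (auto simp: A_def u_def b_def group_algebra_simps)
qed

end
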